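(* Let $I$ be an infinite subset of $E=\{m+ni:(m,n)\in\mathbb N\times\mathbb Z\}$. Then $\overline{J_I}$ is porous if and only if there exist $\theta\in(0,1)$, $\kappa\in(0,1)$ and $\rho>0$ such that for every $i\in I$ and every $R\in[\rho,\kappa|i|]$ there exists some $y_{i,R}\in B(i,R)$ such that $$E\cap B(y_{i,R},\theta R)\subset E\setminus I .$$
   Context: $\mathbb N=\{1,2,\dots\}$; in the superscript-free expression $m+ni$ in the definition of $E$, $i=\sqrt{-1}$, while elsewhere $i$ denotes an element of $I$. $B(z,r)$ is the open Euclidean ball in $\mathbb C$; $y_{i,R}$ is a point of $\mathbb C$. Let $X=\overline B(1/2,1/2)\subset\mathbb C$ and $\phi_e:X\to X$, $\phi_e(z)=1/(e+z)$, for $e\in E$. For $\omega\in I^{\mathbb N}$, $\pi(\omega)$ is the unique point of $\bigcap_n\phi_{\omega_1}\circ\cdots\circ\phi_{\omega_n}(X)$, and $J_I=\pi(I^{\mathbb N})$ is the limit set of the complex continued fractions system $\{\phi_e\}_{e\in I}$; $\overline{J_I}$ is its closure in $\mathbb C$. Porosity (in $\mathbb C$): for a bounded $G\subset\mathbb C$, $x\in\mathbb C$, $r>0$, $\operatorname{por}(G,x,r)=\sup\{c\ge0: B(y,cr)\subset B(x,r)\setminus G\text{ for some }y\in\mathbb C\}$. $G$ is porous if there are $c\in(0,1)$, $r_0>0$ with $\operatorname{por}(G,x,r)\ge c$ for all $x\in G$ and $r\in(0,r_0)$. *)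

theory Defs
  imports "HOL-Analysis.Analysis"
begin

definition cf_alphabet :: "complex set" where
  "cf_alphabet = {of_nat m + of_int n * \<i> | m n. m \<ge> (1::nat)}"

definition cf_space :: "complex set" where
  "cf_space = cball (1/2) (1/2)"

text \<open>Only used on \<^const>\<open>cf_space\<close> with \<open>e\<close> in the alphabet, where \<open>Re (e + z) \<ge> 1\<close>.\<close>

definition cf_map :: "complex \<Rightarrow> complex \<Rightarrow> complex" where
  "cf_map e z = 1 / (e + z)"

text \<open>Words are indexed from \<open>0\<close>, so \<open>cf_comp \<omega> n\<close> is the composition of the maps of the first
  \<open>n\<close> letters \<open>\<omega> 0, \<dots>, \<omega> (n - 1)\<close>, with the first letter outermost.\<close>

primrec cf_comp :: "(nat \<Rightarrow> complex) \<Rightarrow> nat \<Rightarrow> complex \<Rightarrow> complex" where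
  "cf_comp \<omega> 0 = id"
| "cf_comp \<omega> (Suc n) = cf_comp \<omega> n \<circ> cf_map (\<omega> n)"

definition cf_proj :: "(nat \<Rightarrow> complex) \<Rightarrow> complex" where
  "cf_proj \<omega> = (THE z. z \<in> (\<Inter>n\<in>{1..}. cf_comp \<omega> n ` cf_space))"

definition cf_limit_set :: "complex set \<Rightarrow> complex set" where
  "cf_limit_set I = cf_proj ` {\<omega>. \<forall>n. \<omega> n \<in> I}"

text \<open>For \<open>r > 0\<close> the set below contains \<open>0\<close> (the ball of radius \<open>0\<close> is empty) and is bounded
  above by \<open>1\<close>, so the real supremum is the intended one.\<close>

definition por :: "complex set \<Rightarrow> complex \<Rightarrow> real \<Rightarrow> real" where
  "por G x r = Sup {c. c \<ge> 0 \<and> (\<exists>y. ball y (c * r) \<subseteq> ball x r - G)}"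

definition porous :: "complex set \<Rightarrow> bool" where
  "porous G \<longleftrightarrow>
    (\<exists>c r0. 0 < c \<and> c < 1 \<and> 0 < r0 \<and> (\<forall>x\<in>G. \<forall>r. 0 < r \<and> r < r0 \<longrightarrow> por G x r \<ge> c))"

end

(* On X every composition f of n maps satisfies |f z - f w| = b |z - w| / (|1 + u z| |1 + u w|)
   for some u in X and b > 0, so it distorts distances by a bounded factor relative to its scale b,
   and it takes int X - K into the complement of K, where K is the closure of J_I. A ball around a
   limit point therefore contains a hole of comparable size as soon as this holds for balls around
   first level points 1 / (e + z) whose radius t is at least a multiple of |e|^-2. The inversion
   w = 1 / z turns K - {0} into the union of the translates j + K, j in I, and turns such a ball into
   one around e of radius R ~ t |e|^2. For bounded R there is room between the discs j + X; for R
   between constants and kappa |e| holes correspond to gaps of I in the ball B(e, R); for t larger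
   than 1 / |e| the ball contains a neighbourhood of 0 of size ~ t, which requires a gap at distance
   and of size ~ 1 / t from the origin. *)

theory Submission
  imports Defs
begin

section \<open>Bounded distortion of the compositions\<close>

lemma cf_space_iff: "z \<in> cf_space \<longleftrightarrow> (cmod z)\<^sup>2 \<le> Re z"
proof -
  have "z \<in> cf_space \<longleftrightarrow> (cmod (1/2 - z))\<^sup>2 \<le> (1/2)\<^sup>2"
    unfolding cf_space_def mem_cball dist_norm by (subst power_mono_iff) auto
  also have "\<dots> \<longleftrightarrow> (cmod z)\<^sup>2 \<le> Re z"
    unfolding cmod_power2 by (simp add: power2_eq_square algebra_simps) linarith
  finally show ?thesis .
qed

lemma interior_cf_space_iff: "z \<in> interior cf_space \<longleftrightarrow> (cmod z)\<^sup>2 < Re z"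
proof -
  have "z \<in> interior cf_space \<longleftrightarrow> (cmod (1/2 - z))\<^sup>2 < (1/2)\<^sup>2"
    unfolding cf_space_def interior_cball mem_ball dist_norm
    using power_mono_iff[of "1/2" "cmod (1/2 - z)" 2] by (simp add: not_le[symmetric])
  also have "\<dots> \<longleftrightarrow> (cmod z)\<^sup>2 < Re z"
    unfolding cmod_power2 by (simp add: power2_eq_square algebra_simps) linarith
  finally show ?thesis .
qed

lemma cf_spaceD:
  assumes "z \<in> cf_space"
  shows "0 \<le> Re z" "cmod z \<le> 1"
proof -
  have *: "(cmod z)\<^sup>2 \<le> Re z"
    using assms by (simp add: cf_space_iff)
  then show "0 \<le> Re z"
    by (smt (verit) zero_le_power2)
  have "(cmod z)\<^sup>2 \<le> cmod z"
    using * complex_Re_le_cmod[of z] by linarith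
  then show "cmod z \<le> 1"
    by (cases "z = 0") (auto simp: power2_eq_square)
qed

lemma zero_in_cf_space: "0 \<in> cf_space"
  by (simp add: cf_space_iff)

lemma compact_cf_space: "compact cf_space"
  by (simp add: cf_space_def)

text \<open>Inversion exchanges X without the origin and the half plane of real part at least 1:
  \<open>cf_space_iff\<close> compares \<open>Re (1 / w)\<close>, which is Re w / |w|^2, with |1 /
  w|^2.\<close>

lemma inverse_in_cf_space:
  assumes "1 \<le> Re w"
  shows "1 / w \<in> cf_space"
proof -
  have pos: "0 < (cmod w)\<^sup>2"
    using assms by auto
  have "Re (1 / w) = Re w / (cmod w)\<^sup>2" "(cmod (1 / w))\<^sup>2 = 1 / (cmod w)\<^sup>2"
    by (simp_all add: Re_divide cmod_power2 norm_divide power_divide)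
  then show ?thesis
    unfolding cf_space_iff using assms pos by (simp add: divide_right_mono divide_strict_right_mono)
qed

lemma inverse_in_interior_cf_space:
  assumes "1 < Re w"
  shows "1 / w \<in> interior cf_space"
proof -
  have pos: "0 < (cmod w)\<^sup>2"
    using assms by auto
  have "Re (1 / w) = Re w / (cmod w)\<^sup>2" "(cmod (1 / w))\<^sup>2 = 1 / (cmod w)\<^sup>2"
    by (simp_all add: Re_divide cmod_power2 norm_divide power_divide)
  then show ?thesis
    unfolding interior_cf_space_iff using assms pos by (simp add: divide_right_mono divide_strict_right_mono)
qed

section \<open>The alphabet and the single maps\<close>

lemma Re_cf_alphabet: "e \<in> cf_alphabet \<Longrightarrow> 1 \<le> Re e"
  by (auto simp: cf_alphabet_def)

lemma one_le_cmod_cf_alphabet: "e \<in> cf_alphabet \<Longrightarrow> 1 \<le> cmod e"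
  using Re_cf_alphabet complex_Re_le_cmod order_trans by blast

lemma cf_alphabet_diff:
  assumes "e \<in> cf_alphabet" "f \<in> cf_alphabet"
  obtains m n :: int where "e - f = Complex m n"
proof -
  obtain m n m' n' where "e = of_nat m + of_int n * \<i>" "f = of_nat m' + of_int n' * \<i>"
    using assms unfolding cf_alphabet_def by blast
  then have "e - f = Complex (int m - int m') (n - n')"
    by (simp add: complex_eq_iff)
  with that show ?thesis
    by blast
qed

text \<open>Differences of letters are Gaussian integers. This makes I closed, and it makes distinct
  discs j + X overlap at most in boundary points.\<close>

lemma cf_alphabet_separated:
  assumes "e \<in> cf_alphabet" "f \<in> cf_alphabet" "cmod (e - f) < 1"
  shows "e = f"
proof -
  obtain m n :: int where mn: "e - f = Complex m n"
    using cf_alphabet_diff assms by blast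
  have "\<bar>real_of_int m\<bar> < 1" "\<bar>real_of_int n\<bar> < 1"
    using abs_Re_le_cmod[of "e - f"] abs_Im_le_cmod[of "e - f"] assms(3) mn by auto
  then have "m = 0" "n = 0"
    by linarith+
  with mn show ?thesis
    by (simp add: complex_eq_iff)
qed

lemma Re_add_ge_1:
  assumes "e \<in> cf_alphabet" "z \<in> cf_space"
  shows "1 \<le> Re (e + z)"
  using Re_cf_alphabet[OF assms(1)] cf_spaceD(1)[OF assms(2)] by simp

lemma add_nonzero:
  assumes "e \<in> cf_alphabet" "z \<in> cf_space"
  shows "e + z \<noteq> 0"
  using Re_add_ge_1[OF assms] by (metis zero_complex.sel(1) not_one_le_zero)

text \<open>The factor 1/2 comes from averaging |e + z| \<ge> 1 and |e + z| \<ge> |e| - 1, the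
  factor 2 from |z| \<le> 1 \<le> |e|.\<close>

lemma cmod_add_bounds:
  assumes "e \<in> cf_alphabet" "z \<in> cf_space"
  shows "1 \<le> cmod (e + z)" "cmod e / 2 \<le> cmod (e + z)" "cmod (e + z) \<le> 2 * cmod e"
proof -
  show 1: "1 \<le> cmod (e + z)"
    using Re_add_ge_1[OF assms] complex_Re_le_cmod order_trans by blast
  show "cmod e / 2 \<le> cmod (e + z)"
    using 1 norm_diff_ineq[of e z] cf_spaceD(2)[OF assms(2)] by linarith
  show "cmod (e + z) \<le> 2 * cmod e"
    using norm_triangle_ineq[of e z] cf_spaceD(2)[OF assms(2)]
      one_le_cmod_cf_alphabet[OF assms(1)] by linarith
qed

lemma cf_map_in_cf_space:
  assumes "e \<in> cf_alphabet" "z \<in> cf_space"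
  shows "cf_map e z \<in> cf_space"
  unfolding cf_map_def by (intro inverse_in_cf_space Re_add_ge_1 assms)

lemma cf_map_in_interior:
  assumes "e \<in> cf_alphabet" "z \<in> interior cf_space"
  shows "cf_map e z \<in> interior cf_space"
proof -
  have "0 < Re z"
    using assms(2) unfolding interior_cf_space_iff by (smt (verit) zero_le_power2)
  then show ?thesis
    unfolding cf_map_def using Re_cf_alphabet[OF assms(1)]
    by (intro inverse_in_interior_cf_space) simp
qed

section \<open>Compositions: their denominators, scales and distortion\<close>

lemma cf_comp_Suc_shift:
  "cf_comp \<omega> (Suc n) = cf_map (\<omega> 0) \<circ> cf_comp (\<lambda>k. \<omega> (Suc k)) n"
proof (induction n)
  case (Suc n)
  show ?case
    by (subst cf_comp.simps(2), subst Suc.IH) (simp add: o_assoc)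
qed simp

text \<open>The quotient \<open>q(n - 1) / q(n)\<close> of consecutive continuants, and \<open>1 / \<bar>q(n)\<bar>\<^sup>2\<close>: the composition of the first
  \<open>n\<close> maps has denominator \<open>q(n) + q(n - 1) z\<close>.\<close>

primrec cf_ratio :: "(nat \<Rightarrow> complex) \<Rightarrow> nat \<Rightarrow> complex" where
  "cf_ratio \<omega> 0 = 0"
| "cf_ratio \<omega> (Suc n) = cf_map (\<omega> n) (cf_ratio \<omega> n)"

primrec cf_scale :: "(nat \<Rightarrow> complex) \<Rightarrow> nat \<Rightarrow> real" where
  "cf_scale \<omega> 0 = 1"
| "cf_scale \<omega> (Suc n) = cf_scale \<omega> n / (cmod (\<omega> n + cf_ratio \<omega> n))\<^sup>2"

lemma cf_map_diff:
  assumes "e + z \<noteq> 0" "e + w \<noteq> 0"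
  shows "cf_map e z - cf_map e w = (w - z) / ((e + z) * (e + w))"
  using assms by (simp add: cf_map_def field_simps)

context
  fixes \<omega> :: "nat \<Rightarrow> complex"
  assumes letters: "\<And>n. \<omega> n \<in> cf_alphabet"
begin

lemma cf_ratio_in_cf_space: "cf_ratio \<omega> n \<in> cf_space"
  by (induction n) (auto simp: zero_in_cf_space intro: cf_map_in_cf_space letters)

lemma cf_scale_pos: "0 < cf_scale \<omega> n"
  by (induction n) (auto intro!: divide_pos_pos simp: add_nonzero[OF letters cf_ratio_in_cf_space])

text \<open>This is the exact distance formula for a Moebius map whose denominator is proportional
  to 1 + u z. The induction splits off the innermost map, so it has to run over all pairs of
  points.\<close>

lemma cf_comp_diff:
  assumes "z \<in> cf_space" "w \<in> cf_space"
  shows "cmod (cf_comp \<omega> n z - cf_comp \<omega> n w) =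
    cf_scale \<omega> n * cmod (z - w) / (cmod (1 + cf_ratio \<omega> n * z) * cmod (1 + cf_ratio \<omega> n * w))"
  using assms
proof (induction n arbitrary: z w)
  case (Suc n)
  let ?e = "\<omega> n" and ?u = "cf_ratio \<omega> n"
  have nz: "?e + z \<noteq> 0" "?e + w \<noteq> 0" "?e + ?u \<noteq> 0"
    using add_nonzero[OF letters] Suc.prems cf_ratio_in_cf_space by auto
  \<comment> \<open>The factors e + v cancel against those of \<open>cf_map_diff\<close>, and the
    two factors e + u turn the scale of index n into that of index n + 1.\<close>
  have rewr: "1 + ?u * cf_map ?e v = (1 + cf_map ?e ?u * v) * (?e + ?u) / (?e + v)"
    if "?e + v \<noteq> 0" for v
  proof -
    have "(1 + cf_map ?e ?u * v) * (?e + ?u) = ?e + v + ?u"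
      using nz(3) by (simp add: cf_map_def distrib_right)
    then show ?thesis
      using that by (simp add: cf_map_def add_divide_distrib)
  qed
  have "cmod (cf_comp \<omega> (Suc n) z - cf_comp \<omega> (Suc n) w) = cf_scale \<omega> n *
      cmod (cf_map ?e z - cf_map ?e w) /
      (cmod (1 + ?u * cf_map ?e z) * cmod (1 + ?u * cf_map ?e w))"
    using Suc.IH[OF cf_map_in_cf_space cf_map_in_cf_space, OF letters Suc.prems(1) letters Suc.prems(2)]
    by simp
  also have "\<dots> = cf_scale \<omega> (Suc n) * cmod (z - w) /
      (cmod (1 + cf_ratio \<omega> (Suc n) * z) * cmod (1 + cf_ratio \<omega> (Suc n) * w))"
    unfolding rewr[OF nz(1)] rewr[OF nz(2)] cf_map_diff[OF nz(1,2)]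
    using nz by (simp add: norm_mult norm_divide norm_minus_commute power2_eq_square)
  finally show ?case .
qed auto

text \<open>Two consecutive denominators satisfy \<open>\<bar>e' + w\<bar> \<bar>e + u\<bar> = \<bar>e' + w\<bar> / \<bar>w\<bar> \<ge> (1 + \<bar>w\<bar>\<^sup>2) / \<bar>w\<bar> \<ge> 2\<close>
  for \<open>w = 1 / (e + u)\<close>; a single map need not contract, as \<open>\<phi>\<^sub>1\<close> has derivative of modulus \<open>1\<close> at \<open>0\<close>.\<close>

lemma cf_scale_Suc_Suc: "cf_scale \<omega> (Suc (Suc n)) \<le> cf_scale \<omega> n / 4"
proof -
  let ?v = "\<omega> n + cf_ratio \<omega> n" and ?w = "cf_ratio \<omega> (Suc n)"
  have w: "?w \<in> cf_space"
    by (rule cf_ratio_in_cf_space)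
  have v0: "?v \<noteq> 0"
    using add_nonzero[OF letters cf_ratio_in_cf_space] .
  have vw: "cmod ?v * cmod ?w = 1"
    using v0 by (simp add: cf_map_def norm_divide)
  have "2 * cmod ?w \<le> 1 + (cmod ?w)\<^sup>2"
    using sum_squares_bound[of 1 "cmod ?w"] by simp
  also have "\<dots> \<le> Re (\<omega> (Suc n) + ?w)"
    using w Re_cf_alphabet[OF letters[of "Suc n"]] unfolding cf_space_iff by simp
  also have "\<dots> \<le> cmod (\<omega> (Suc n) + ?w)"
    by (rule complex_Re_le_cmod)
  finally have "cmod ?v * (2 * cmod ?w) \<le> cmod ?v * cmod (\<omega> (Suc n) + ?w)"
    by (rule mult_left_mono) simp
  then have "2 * (cmod ?v * cmod ?w) \<le> cmod ?v * cmod (\<omega> (Suc n) + ?w)"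
    by (simp only: mult_ac)
  then have "2 \<le> cmod ?v * cmod (\<omega> (Suc n) + ?w)"
    using vw by simp
  then have "2\<^sup>2 \<le> (cmod ?v * cmod (\<omega> (Suc n) + ?w))\<^sup>2"
    by (rule power_mono) simp
  then have "4 \<le> (cmod ?v)\<^sup>2 * (cmod (\<omega> (Suc n) + ?w))\<^sup>2"
    by (simp add: power_mult_distrib)
  then have "cf_scale \<omega> n / ((cmod ?v)\<^sup>2 * (cmod (\<omega> (Suc n) + ?w))\<^sup>2) \<le> cf_scale \<omega> n / 4"
    using cf_scale_pos[of n] by (intro divide_left_mono) auto
  then show ?thesis
    by simp
qed

text \<open>Contraction is available for two maps at a time, so decay is followed along odd indices.
  The index \<open>Suc n\<close> guarantees a nonempty word.\<close>

lemma cf_scale_small: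
  assumes "0 < \<epsilon>"
  obtains n where "cf_scale \<omega> (Suc n) < \<epsilon>"
proof -
  have bound: "cf_scale \<omega> (Suc (2 * k)) \<le> cf_scale \<omega> 1 * (1/4) ^ k" for k
  proof (induction k)
    case (Suc k)
    then show ?case
      using cf_scale_Suc_Suc[of "Suc (2 * k)"] by simp
  qed simp
  have "(\<lambda>k. cf_scale \<omega> 1 * (1/4) ^ k) \<longlonglongrightarrow> cf_scale \<omega> 1 * 0"
    by (intro tendsto_mult_left LIMSEQ_realpow_zero) auto
  then have "eventually (\<lambda>k. cf_scale \<omega> 1 * (1/4) ^ k < \<epsilon>) sequentially"
    using assms by (auto dest: order_tendstoD(2))
  then obtain k where "cf_scale \<omega> 1 * (1/4) ^ k < \<epsilon>"
    by (auto simp: eventually_sequentially)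
  with bound[of k] that show ?thesis
    by (meson le_less_trans)
qed

text \<open>Bounds the loss of scale caused by one letter; it later shows that a rescaled radius is
  at least 16 / |e|^2.\<close>

lemma cf_scale_Suc_ge: "cf_scale \<omega> n \<le> 4 * (cmod (\<omega> n))\<^sup>2 * cf_scale \<omega> (Suc n)"
proof -
  let ?v = "\<omega> n + cf_ratio \<omega> n"
  have "(cmod ?v)\<^sup>2 \<le> (2 * cmod (\<omega> n))\<^sup>2"
    using cmod_add_bounds(3)[OF letters cf_ratio_in_cf_space] by (intro power_mono) auto
  then have "cf_scale \<omega> n * (cmod ?v)\<^sup>2 \<le> cf_scale \<omega> n * (4 * (cmod (\<omega> n))\<^sup>2)"
    using cf_scale_pos[of n] by (intro mult_left_mono) (auto simp: power_mult_distrib)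
  then show ?thesis
    using add_nonzero[OF letters cf_ratio_in_cf_space[of n]] by (simp add: field_simps)
qed

end

text \<open>For |u| \<le> 1/2 the lower bound is the triangle inequality. Otherwise 1 + u z = u (1/u
  + z), where 1/u has real part at least 1, so the modulus is at least |u|.\<close>

lemma cmod_one_plus_mult_bounds:
  assumes "u \<in> cf_space" "z \<in> cf_space"
  shows "1/2 \<le> cmod (1 + u * z)" "cmod (1 + u * z) \<le> 2"
proof -
  have prod: "cmod (u * z) \<le> cmod u" "cmod u \<le> 1"
    using cf_spaceD(2)[OF assms(1)] cf_spaceD(2)[OF assms(2)]
    by (auto simp: norm_mult intro: mult_left_le)
  then show "cmod (1 + u * z) \<le> 2"
    using norm_triangle_ineq[of 1 "u * z"] by simp
  show "1/2 \<le> cmod (1 + u * z)"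
  proof (cases "cmod u \<le> 1/2")
    case True
    then show ?thesis
      using prod norm_diff_ineq[of 1 "u * z"] by simp
  next
    case False
    then have u0: "u \<noteq> 0"
      by auto
    have "(cmod u)\<^sup>2 \<le> Re u"
      using assms(1) by (simp add: cf_space_iff)
    then have "1 \<le> Re (1 / u)"
      using u0 by (simp add: Re_divide cmod_power2 complex_eq_iff sum_power2_gt_zero_iff)
    then have "1 \<le> cmod (1 / u + z)"
      using cf_spaceD(1)[OF assms(2)] complex_Re_le_cmod[of "1 / u + z"] by simp
    then have "cmod u * 1 \<le> cmod u * cmod (1 / u + z)"
      by (intro mult_left_mono) auto
    also have "\<dots> = cmod (1 + u * z)"
      using u0 by (simp add: norm_mult[symmetric] distrib_left)
    finally show ?thesis
      using False by simp
  qed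
qed

context
  fixes \<omega> :: "nat \<Rightarrow> complex"
  assumes letters: "\<And>n. \<omega> n \<in> cf_alphabet"
begin

text \<open>The product of the two denominators in \<open>cf_comp_diff\<close> lies between 1/4 and
  4, uniformly in the word and its length.\<close>

lemma cf_comp_bilipschitz:
  assumes "z \<in> cf_space" "w \<in> cf_space"
  shows "cf_scale \<omega> n / 4 * dist z w \<le> dist (cf_comp \<omega> n z) (cf_comp \<omega> n w)"
    and "dist (cf_comp \<omega> n z) (cf_comp \<omega> n w) \<le> 4 * cf_scale \<omega> n * dist z w"
proof -
  define p where "p = cmod (1 + cf_ratio \<omega> n * z) * cmod (1 + cf_ratio \<omega> n * w)"
  note b = cmod_one_plus_mult_bounds[OF cf_ratio_in_cf_space[of \<omega>, OF letters, of n]]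
  have p: "1/4 \<le> p" "p \<le> 4"
    unfolding p_def
    using mult_mono[OF b(1)[OF assms(1)] b(1)[OF assms(2)]]
      mult_mono[OF b(2)[OF assms(1)] b(2)[OF assms(2)]] by auto
  have eq: "dist (cf_comp \<omega> n z) (cf_comp \<omega> n w) = cf_scale \<omega> n * dist z w / p"
    unfolding dist_norm p_def by (rule cf_comp_diff[of \<omega>, OF letters assms])
  have q: "0 \<le> cf_scale \<omega> n * dist z w"
    using cf_scale_pos[of \<omega>, OF letters, of n] by simp
  show "cf_scale \<omega> n / 4 * dist z w \<le> dist (cf_comp \<omega> n z) (cf_comp \<omega> n w)"
    unfolding eq using divide_left_mono[OF p(2) q] p by simp
  show "dist (cf_comp \<omega> n z) (cf_comp \<omega> n w) \<le> 4 * cf_scale \<omega> n * dist z w"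
    unfolding eq using divide_left_mono[OF p(1) q] p by (simp add: mult_ac)
qed

section \<open>The coding map from words to limit points\<close>

lemma continuous_on_cf_comp: "continuous_on cf_space (cf_comp \<omega> n)"
proof (rule continuous_on_subset[OF lipschitz_on_continuous_on])
  show "(4 * cf_scale \<omega> n)-lipschitz_on cf_space (cf_comp \<omega> n)"
    using cf_comp_bilipschitz(2) cf_scale_pos[of \<omega>, OF letters, of n]
    by (intro lipschitz_onI) auto
qed simp

lemma cf_comp_image_decreasing: "cf_comp \<omega> (Suc n) ` cf_space \<subseteq> cf_comp \<omega> n ` cf_space"
  using cf_map_in_cf_space[OF letters] by (auto simp: image_comp[symmetric])

text \<open>Justifies the definite description in \<open>cf_proj\<close>: nested nonempty compact
  sets have a common point, and their diameters tend to 0.\<close>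

lemma cf_proj_ex1: "\<exists>!z. z \<in> (\<Inter>n\<in>{1..}. cf_comp \<omega> n ` cf_space)"
proof (rule ex_ex1I)
  have "\<Inter> (range (\<lambda>n. cf_comp \<omega> n ` cf_space)) \<noteq> {}"
  proof (rule compact_nest)
    show "compact (cf_comp \<omega> n ` cf_space)" for n
      by (intro compact_continuous_image continuous_on_cf_comp compact_cf_space)
    show "cf_comp \<omega> n ` cf_space \<noteq> {}" for n
      using zero_in_cf_space by blast
    show "cf_comp \<omega> n ` cf_space \<subseteq> cf_comp \<omega> m ` cf_space" if "m \<le> n" for m n
      using cf_comp_image_decreasing that by (rule lift_Suc_antimono_le)
  qed
  then show "\<exists>z. z \<in> (\<Inter>n\<in>{1..}. cf_comp \<omega> n ` cf_space)"
    by auto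
next
  fix x y
  assume xy: "x \<in> (\<Inter>n\<in>{1..}. cf_comp \<omega> n ` cf_space)"
    "y \<in> (\<Inter>n\<in>{1..}. cf_comp \<omega> n ` cf_space)"
  show "x = y"
  proof (rule ccontr)
    assume "x \<noteq> y"
    \<comment> \<open>The 8 is the Lipschitz factor 4 times the bound 2 for distances in X.\<close>
    then obtain n where n: "cf_scale \<omega> (Suc n) < dist x y / 8"
      using cf_scale_small[of \<omega> "dist x y / 8"] letters by auto
    obtain z w where zw: "z \<in> cf_space" "w \<in> cf_space"
      "x = cf_comp \<omega> (Suc n) z" "y = cf_comp \<omega> (Suc n) w"
      using xy by (fastforce simp del: cf_comp.simps)
    have "dist z w \<le> 2"
      using norm_triangle_ineq4[of z w] cf_spaceD(2)[OF zw(1)] cf_spaceD(2)[OF zw(2)]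
      by (simp add: dist_norm)
    then have "4 * cf_scale \<omega> (Suc n) * dist z w \<le> 4 * cf_scale \<omega> (Suc n) * 2"
      using cf_scale_pos[of \<omega>, OF letters, of "Suc n"] by (intro mult_left_mono) auto
    then show False
      using cf_comp_bilipschitz(2)[OF zw(1,2), of "Suc n", folded zw(3,4)] n by linarith
  qed
qed

lemma cf_proj_in_image: "n \<ge> 1 \<Longrightarrow> cf_proj \<omega> \<in> cf_comp \<omega> n ` cf_space"
  using theI'[OF cf_proj_ex1] unfolding cf_proj_def by auto

lemma cf_proj_eqI:
  assumes "\<And>n. n \<ge> 1 \<Longrightarrow> z \<in> cf_comp \<omega> n ` cf_space"
  shows "cf_proj \<omega> = z"
  unfolding cf_proj_def using assms by (intro the1_equality cf_proj_ex1) auto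

lemma cf_proj_in_cf_space: "cf_proj \<omega> \<in> cf_space"
  using cf_proj_in_image[of 1] cf_map_in_cf_space[OF letters] by auto

end

lemma cf_proj_shift:
  assumes letters: "\<And>n. \<omega> n \<in> cf_alphabet"
  shows "cf_proj \<omega> = cf_map (\<omega> 0) (cf_proj (\<lambda>k. \<omega> (Suc k)))"
proof (rule cf_proj_eqI)
  fix n :: nat
  assume "n \<ge> 1"
  then obtain m where n: "n = Suc m"
    by (cases n) auto
  \<comment> \<open>The intersection defining \<open>cf_proj\<close> starts at index 1, so for m = 0
    membership in X itself is used.\<close>
  have "cf_proj (\<lambda>k. \<omega> (Suc k)) \<in> cf_comp (\<lambda>k. \<omega> (Suc k)) m ` cf_space"
    using cf_proj_in_image[of "\<lambda>k. \<omega> (Suc k)" m] cf_proj_in_cf_space[of "\<lambda>k. \<omega> (Suc k)"] letters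
    by (cases m) auto
  then show "cf_map (\<omega> 0) (cf_proj (\<lambda>k. \<omega> (Suc k))) \<in> cf_comp \<omega> n ` cf_space"
    unfolding n cf_comp_Suc_shift by auto
qed (rule letters)

lemma cf_proj_eq_cf_comp:
  assumes letters: "\<And>n. \<omega> n \<in> cf_alphabet"
  shows "cf_proj \<omega> = cf_comp \<omega> n (cf_proj (\<lambda>k. \<omega> (n + k)))"
proof (induction n)
  case (Suc n)
  then show ?case
    using cf_proj_shift[of "\<lambda>k. \<omega> (n + k)"] letters by simp
qed simp

section \<open>The closure of the limit set\<close>

context
  fixes I :: "complex set"
  assumes I: "I \<subseteq> cf_alphabet"
begin

lemma cf_limit_set_subset: "cf_limit_set I \<subseteq> cf_space"
  using cf_proj_in_cf_space I by (fastforce simp: cf_limit_set_def)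

lemma closure_cf_limit_set_subset: "closure (cf_limit_set I) \<subseteq> cf_space"
  by (rule closure_minimal[OF cf_limit_set_subset]) (simp add: cf_space_def)

lemma cf_map_in_cf_limit_set:
  assumes "e \<in> I" "z \<in> cf_limit_set I"
  shows "cf_map e z \<in> cf_limit_set I"
proof -
  obtain \<omega> where \<omega>: "\<forall>n. \<omega> n \<in> I" "z = cf_proj \<omega>"
    using assms(2) by (auto simp: cf_limit_set_def)
  let ?\<omega> = "case_nat e \<omega>"
  have "\<forall>n. ?\<omega> n \<in> I"
    using \<omega>(1) assms(1) by (simp split: nat.split)
  moreover from this have "cf_proj ?\<omega> = cf_map e z"
    using cf_proj_shift[of ?\<omega>] I \<omega>(2) by auto
  ultimately show ?thesis
    by (auto simp: cf_limit_set_def intro!: image_eqI[of _ _ ?\<omega>])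
qed

lemma cf_limit_setE:
  assumes "x \<in> cf_limit_set I"
  obtains e z where "e \<in> I" "z \<in> cf_limit_set I" "x = cf_map e z"
proof -
  obtain \<omega> where \<omega>: "\<forall>n. \<omega> n \<in> I" "x = cf_proj \<omega>"
    using assms by (auto simp: cf_limit_set_def)
  then have "x = cf_map (\<omega> 0) (cf_proj (\<lambda>k. \<omega> (Suc k)))"
    using cf_proj_shift[of \<omega>] I by auto
  with \<omega>(1) that[of "\<omega> 0" "cf_proj (\<lambda>k. \<omega> (Suc k))"] show ?thesis
    by (auto simp: cf_limit_set_def)
qed

lemma closed_letters: "closed I"
  by (rule discrete_imp_closed[of 1]) (use I cf_alphabet_separated in \<open>auto simp: dist_norm\<close>)

text \<open>The sum of the compact closure K and the closed set I is closed. It contains the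
  inverses of all limit points, hence of their nonzero limits, where inversion is
  continuous.\<close>

lemma closure_cf_limit_setE:
  assumes "x \<in> closure (cf_limit_set I)" "x \<noteq> 0"
  obtains j k where "j \<in> I" "k \<in> closure (cf_limit_set I)" "1 / x = j + k"
proof -
  let ?K = "closure (cf_limit_set I)"
  let ?W = "\<Union>k\<in>?K. \<Union>j\<in>I. {k + j}"
  have "compact ?K"
    using closure_cf_limit_set_subset compact_cf_space
    by (metis closed_closure compact_Int_closed inf.absorb_iff2)
  then have closed: "closed ?W"
    by (intro compact_closed_sums closed_letters)
  obtain X where X: "\<And>n. X n \<in> cf_limit_set I" "X \<longlonglongrightarrow> x"
    using assms(1) by (auto simp: closure_sequential)
  have "1 / X n \<in> ?W" for n
  proof -
    obtain e z where "e \<in> I" "z \<in> cf_limit_set I" "X n = cf_map e z"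
      using cf_limit_setE[OF X(1)] .
    moreover from this have "z \<in> ?K" "1 / X n = z + e"
      using closure_subset by (auto simp: cf_map_def)
    ultimately show ?thesis
      by blast
  qed
  moreover have "(\<lambda>n. 1 / X n) \<longlonglongrightarrow> 1 / x"
    by (intro tendsto_divide tendsto_const X(2) assms(2))
  ultimately have "1 / x \<in> ?W"
    by (rule closed_sequentially[OF closed])
  with that show ?thesis
    by (auto simp: add.commute)
qed

text \<open>If e + v = j + k with v in the open and k in the closed disc, then |e - j| < 1, so e =
  j. The interior is essential, as neighbouring discs touch.\<close>

lemma cf_map_in_closureD:
  assumes "e \<in> I" "v \<in> interior cf_space" "cf_map e v \<in> closure (cf_limit_set I)"
  shows "v \<in> closure (cf_limit_set I)"
proof -
  have e: "e \<in> cf_alphabet" and v: "v \<in> cf_space"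
    using assms I interior_subset by auto
  have "cf_map e v \<noteq> 0"
    using add_nonzero[OF e v] by (simp add: cf_map_def)
  then obtain j k where jk: "j \<in> I" "k \<in> closure (cf_limit_set I)" "e + v = j + k"
    using closure_cf_limit_setE[OF assms(3)] by (metis cf_map_def div_by_1 divide_divide_eq_right mult_1)
  have "k \<in> cf_space"
    using jk(2) closure_cf_limit_set_subset by blast
  then have "cmod (1/2 - v) < 1/2" "cmod (1/2 - k) \<le> 1/2"
    using assms(2) by (auto simp: cf_space_def dist_norm interior_cball)
  moreover have "e - j = (1/2 - v) - (1/2 - k)"
    using jk(3) by (simp add: algebra_simps)
  moreover have "cmod (1/2 - v - (1/2 - k)) \<le> cmod (1/2 - v) + cmod (1/2 - k)"
    by (rule norm_triangle_ineq4)
  ultimately have "cmod (e - j) < 1"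
    by simp
  then have "e = j"
    using cf_alphabet_separated e I jk(1) by blast
  then show ?thesis
    using jk(2,3) by simp
qed

text \<open>Read contrapositively: a hole of K inside the interior of X is carried by every
  composition to points outside K.\<close>

lemma cf_comp_in_closureD:
  assumes "\<And>n. \<omega> n \<in> I" "v \<in> interior cf_space" "cf_comp \<omega> n v \<in> closure (cf_limit_set I)"
  shows "v \<in> closure (cf_limit_set I)"
  using assms(2,3)
proof (induction n arbitrary: v)
  case (Suc n)
  have "cf_map (\<omega> n) v \<in> interior cf_space"
    using cf_map_in_interior assms(1) I Suc.prems(1) by blast
  then have "cf_map (\<omega> n) v \<in> closure (cf_limit_set I)"
    using Suc.IH Suc.prems(2) by simp
  then show ?case
    using cf_map_in_closureD Suc.prems(1) assms(1) by blast
qed simp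

end

section \<open>Porosity and inversion\<close>

lemma por_ge:
  assumes "0 \<le> c" "0 < r" "ball y (c * r) \<subseteq> ball x r - G"
  shows "c \<le> por G x r"
  unfolding por_def
proof (rule cSup_upper)
  show "bdd_above {c. c \<ge> 0 \<and> (\<exists>y. ball y (c * r) \<subseteq> ball x r - G)}"
  proof (rule bdd_aboveI[of _ 1])
    fix a :: real
    assume "a \<in> {c. c \<ge> 0 \<and> (\<exists>y. ball y (c * r) \<subseteq> ball x r - G)}"
    then obtain z where "0 \<le> a" "ball z (a * r) \<subseteq> ball x r"
      by blast
    then have "dist z x + a * r \<le> r \<or> a * r \<le> 0"
      by (simp add: ball_subset_ball_iff)
    then have "a * r \<le> 1 * r"
      using assms(2) zero_le_dist[of z x] by linarith
    then show "a \<le> 1"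
      using assms(2) by simp
  qed
qed (use assms in auto)

text \<open>The inequality is strict because the supremum need not be attained.\<close>

lemma por_geE:
  assumes "c < por G x r" "0 < r"
  obtains y where "ball y (c * r) \<subseteq> ball x r - G"
proof -
  let ?S = "{c. c \<ge> 0 \<and> (\<exists>y. ball y (c * r) \<subseteq> ball x r - G)}"
  have "0 \<in> ?S"
    by simp
  then have "?S \<noteq> {}"
    by (rule ex_in_conv[THEN iffD1, OF exI])
  then obtain d where "d \<in> ?S" "c < d"
    by (rule less_cSupE[OF assms(1)[unfolded por_def]])
  then obtain y where "ball y (d * r) \<subseteq> ball x r - G"
    by blast
  moreover have "ball y (c * r) \<subseteq> ball y (d * r)"
    using \<open>c < d\<close> assms(2) by (intro subset_ball mult_right_mono) auto
  ultimately show ?thesis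
    using that by blast
qed

section \<open>Distances under inversion, and gaps obtained from porosity\<close>

lemma inverse_dist:
  fixes v w :: complex
  assumes "v \<noteq> 0" "w \<noteq> 0"
  shows "dist (1 / v) (1 / w) = dist v w / (cmod v * cmod w)"
proof -
  have "1 / v - 1 / w = (w - v) / (v * w)"
    using assms by (simp add: field_simps)
  then show ?thesis
    by (simp add: dist_norm norm_divide norm_mult norm_minus_commute)
qed

text \<open>One fixed limit point z attaches the limit point 1 / (e + z) to each letter e. A hole of
  K near 1 / (i + z) turns under inversion into a region free of points e + z, and since |z| \<le> 1
  it yields a region free of letters.\<close>

lemma gaps_of_porous:
  assumes I: "I \<subseteq> cf_alphabet" "I \<noteq> {}" and por: "porous (closure (cf_limit_set I))"
  obtains \<theta> \<kappa> \<rho> where "0 < \<theta>" "\<theta> < 1" "0 < \<kappa>" "\<kappa> < 1" "0 < \<rho>"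
    "\<And>i R. \<lbrakk>i \<in> I; \<rho> \<le> R; R \<le> \<kappa> * cmod i\<rbrakk> \<Longrightarrow> \<exists>y\<in>ball i R. I \<inter> ball y (\<theta> * R) = {}"
proof -
  let ?K = "closure (cf_limit_set I)"
  \<comment> \<open>The porosity constant is halved to obtain the strict inequality that
    \<open>por_geE\<close> requires.\<close>
  obtain c r0 where c: "0 < c" "c < 1" "0 < r0"
    and hole: "\<And>x r. \<lbrakk>x \<in> ?K; 0 < r; r < r0\<rbrakk> \<Longrightarrow> 2 * c \<le> por ?K x r"
  proof -
    obtain c r0 where "0 < c" "c < 1" "0 < r0" "\<forall>x\<in>?K. \<forall>r. 0 < r \<and> r < r0 \<longrightarrow> por ?K x r \<ge> c"
      using por unfolding porous_def by blast
    with that[of "c / 2" r0] show ?thesis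
      by auto
  qed
  obtain i0 where "i0 \<in> I"
    using I(2) by blast
  then have "cf_proj (\<lambda>_. i0) \<in> cf_limit_set I"
    by (auto simp: cf_limit_set_def)
  then obtain z where z: "z \<in> cf_limit_set I"
    by blast
  have zX: "z \<in> cf_space"
    using z cf_limit_set_subset[OF I(1)] by blast
  \<comment> \<open>\<open>\<rho>\<close> forces c R \<ge> 400, so the unit error from |z| \<le> 1
    is absorbed: 12 (\<theta> R + 1) \<le> c R / 16. In \<open>\<kappa>\<close> the bound r0 keeps
    the radius admissible, and 1/8 keeps the moduli involved comparable to |i| or 1 / |i|.\<close>
  define \<theta> where "\<theta> = c / 400"
  define \<kappa> where "\<kappa> = min r0 (1/8)"
  define \<rho> where "\<rho> = 400 / c"
  show thesis
  proof (rule that[of \<theta> \<kappa> \<rho>])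
    show "0 < \<theta>" "\<theta> < 1" "0 < \<kappa>" "\<kappa> < 1" "0 < \<rho>"
      using c by (auto simp: \<theta>_def \<kappa>_def \<rho>_def)
  next
    fix i R
    assume i: "i \<in> I" and R: "\<rho> \<le> R" "R \<le> \<kappa> * cmod i"
    let ?N = "cmod i"
    have iE: "i \<in> cf_alphabet"
      using i I(1) by blast
    have N1: "1 \<le> ?N" "i \<noteq> 0"
      using one_le_cmod_cf_alphabet[OF iE] by auto
    have R400: "400 \<le> c * R"
      using R(1) c(1) by (simp add: \<rho>_def field_simps)
    have "400 < 400 / c"
      using c by (simp add: field_simps)
    then have cR: "c * R < R" "400 < R"
      using R(1) c(2) by (simp_all add: \<rho>_def)
    have RN: "R \<le> ?N / 8" "R \<le> r0 * ?N"
    proof -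
      have "\<kappa> * ?N \<le> 1/8 * ?N" "\<kappa> * ?N \<le> r0 * ?N"
        by (intro mult_right_mono; simp add: \<kappa>_def)+
      then show "R \<le> ?N / 8" "R \<le> r0 * ?N"
        using R(2) by linarith+
    qed
    have \<theta>R: "\<theta> * R = c * R / 400"
      by (simp add: \<theta>_def)
    let ?w = "i + z"
    note w = cmod_add_bounds[OF iE zX]
    have w0: "?w \<noteq> 0"
      by (rule add_nonzero[OF iE zX])
    define x where "x = 1 / ?w"
    have x0: "x \<noteq> 0" "1 / x = ?w"
      using w0 by (auto simp: x_def)
    have xJ: "x \<in> cf_limit_set I"
      using cf_map_in_cf_limit_set[OF I(1) i z] by (simp add: x_def cf_map_def)
    have normx: "1 / (2 * ?N) \<le> cmod x" "cmod x \<le> 2 / ?N"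
    proof -
      have "cmod x = 1 / cmod ?w"
        by (simp add: x_def norm_divide)
      moreover have "1 / (2 * ?N) \<le> 1 / cmod ?w" "1 / cmod ?w \<le> 1 / (?N / 2)"
        using w N1 w0 by (intro frac_le; force)+
      ultimately show "1 / (2 * ?N) \<le> cmod x" "cmod x \<le> 2 / ?N"
        by simp_all
    qed
    \<comment> \<open>Inversion expands the distance from y to x by at most 8 |i|^2, so 1 / y falls
      within R / 2 of i + z, which leaves room for |z| \<le> 1.\<close>
    define r where "r = R / (16 * ?N\<^sup>2)"
    have rpos: "0 < r"
      using cR(2) N1 by (auto simp: r_def intro!: divide_pos_pos)
    have "r \<le> ?N / 8 / (16 * ?N\<^sup>2)"
      unfolding r_def using RN(1) by (intro divide_right_mono) auto
    also have "\<dots> = 1 / (128 * ?N)"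
      using N1 by (simp add: power2_eq_square)
    also have "\<dots> \<le> 1 / (4 * ?N)"
      using N1 by (intro divide_left_mono) auto
    finally have rN: "r \<le> 1 / (4 * ?N)" .
    have "r \<le> r0 * ?N / (16 * ?N\<^sup>2)"
      unfolding r_def using RN(2) by (intro divide_right_mono) auto
    also have "\<dots> = r0 / (16 * ?N)"
      using N1 by (simp add: power2_eq_square)
    also have "\<dots> \<le> r0 / 16"
      using N1 c(3) by (intro divide_left_mono) auto
    also have "\<dots> < r0"
      using c(3) by simp
    finally have rr0: "r < r0" .
    have "c < por ?K x r"
      using hole[OF subsetD[OF closure_subset xJ] rpos rr0] c(1) by linarith
    then obtain y where y: "ball y (c * r) \<subseteq> ball x r - ?K"
      using por_geE rpos by blast
    have "y \<in> ball y (c * r)"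
      using c(1) rpos by simp
    with y have "y \<in> ball x r"
      by blast
    then have yx: "dist x y < r"
      by simp
    have normy: "1 / (4 * ?N) \<le> cmod y" "cmod y \<le> 3 / ?N"
    proof -
      have d: "cmod x - cmod y \<le> dist x y" "cmod y - cmod x \<le> dist x y"
        by (metis dist_norm norm_triangle_ineq2) (metis dist_norm norm_minus_commute norm_triangle_ineq2)
      have e: "1 / (2 * ?N) = 2 * (1 / (4 * ?N))" "2 / ?N = 8 * (1 / (4 * ?N))" "3 / ?N = 12 * (1 / (4 * ?N))"
        by simp_all
      have f: "0 < 1 / (4 * ?N)"
        using N1 by (intro divide_pos_pos) auto
      show "1 / (4 * ?N) \<le> cmod y"
        using d(1) yx rN normx(1) unfolding e by linarith
      show "cmod y \<le> 3 / ?N"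
        using d(2) yx rN normx(2) f unfolding e by linarith
    qed
    have y0: "y \<noteq> 0"
      using normy(1) N1 by auto
    define y' where "y' = 1 / y"
    have y'0: "y' \<noteq> 0" "1 / y' = y"
      using y0 by (auto simp: y'_def)
    have "dist y' ?w = dist x y / (cmod y * cmod x)"
      using inverse_dist[OF y0 x0(1)] x0(2) by (simp add: y'_def dist_commute)
    also have "\<dots> \<le> dist x y / (1 / (4 * ?N) * (1 / (2 * ?N)))"
      using normx(1) normy(1) N1 x0 y0 by (intro divide_left_mono mult_mono mult_pos_pos divide_pos_pos) auto
    also have "\<dots> = dist x y * (8 * ?N\<^sup>2)"
      by (simp add: power2_eq_square)
    also have "\<dots> < r * (8 * ?N\<^sup>2)"
      using yx N1 by (intro mult_strict_right_mono) auto
    also have "\<dots> = R / 2"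
      using N1 by (simp add: r_def)
    finally have y'w: "dist y' ?w < R / 2" .
    have "dist ?w i \<le> 1"
      using cf_spaceD(2)[OF zX] by (simp add: dist_norm)
    then have y'i: "dist y' i < R"
      using y'w dist_triangle[of y' i ?w] cR(2) by linarith
    \<comment> \<open>A letter e in this ball would have modulus comparable to |i| and would put the
      limit point 1 / (e + z) into the hole around y.\<close>
    have "I \<inter> ball y' (\<theta> * R) = {}"
    proof (rule ccontr)
      assume "I \<inter> ball y' (\<theta> * R) \<noteq> {}"
      then obtain e where e: "e \<in> I" "dist y' e < \<theta> * R"
        by auto
      let ?v = "e + z"
      have "dist e ?v \<le> 1"
        using cf_spaceD(2)[OF zX] by (simp add: dist_norm)
      then have y'v: "dist y' ?v < \<theta> * R + 1"
        using e(2) dist_triangle[of y' ?v e] by linarith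
      have v0: "?v \<noteq> 0"
        using add_nonzero e(1) I(1) zX by blast
      have "dist ?w ?v < R / 2 + \<theta> * R + 1"
        using y'v y'w dist_triangle3[of ?w ?v y'] by linarith
      then have "cmod ?w - cmod ?v < R / 2 + \<theta> * R + 1"
        by (metis dist_norm le_less_trans norm_triangle_ineq2)
      then have normv: "?N / 4 \<le> cmod ?v"
        using w(2) RN(1) cR \<theta>R by linarith
      have "1 / ?v \<in> cf_limit_set I"
        using cf_map_in_cf_limit_set[OF I(1) e(1) z] by (simp add: cf_map_def)
      then have "1 / ?v \<in> ?K"
        using closure_subset by blast
      have "dist y (1 / ?v) = dist y' ?v * cmod y / cmod ?v"
        using inverse_dist[OF y'0(1) v0] by (simp add: y'0(2)) (simp add: y'_def norm_divide)
      also have "\<dots> \<le> dist y' ?v * (3 / ?N) / (?N / 4)"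
        using normv normy(2) N1 by (intro frac_le mult_left_mono) auto
      also have "\<dots> = dist y' ?v * 12 / ?N\<^sup>2"
        by (simp add: power2_eq_square)
      also have "\<dots> < (\<theta> * R + 1) * 12 / ?N\<^sup>2"
        using y'v N1 by (intro divide_strict_right_mono) auto
      also have "\<dots> \<le> (c * R / 16) / ?N\<^sup>2"
      proof (rule divide_right_mono)
        show "(\<theta> * R + 1) * 12 \<le> c * R / 16"
          using R400 unfolding \<theta>R by (simp add: field_simps)
      qed simp
      also have "\<dots> = c * r"
        by (simp add: r_def)
      finally have "1 / ?v \<in> ball y (c * r)"
        by simp
      with y \<open>1 / ?v \<in> ?K\<close> show False
        by blast
    qed
    with y'i show "\<exists>y\<in>ball i R. I \<inter> ball y (\<theta> * R) = {}"
      by (intro bexI[of _ y']) (auto simp: dist_commute)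
  qed
qed

section \<open>Gaps between the translates\<close>

text \<open>Chosen so that inverses of gap points lie in the interior of X and outside K. Avoiding
  the full discs j + X instead of j + K makes the condition depend on the letters alone.\<close>

definition cf_gap :: "complex set \<Rightarrow> complex set" where
  "cf_gap I = {w. 1 < Re w \<and> (\<forall>j\<in>I. w - j \<notin> cf_space)}"

lemma inverse_cf_gap:
  assumes I: "I \<subseteq> cf_alphabet" and w: "w \<in> cf_gap I"
  shows "1 / w \<in> interior cf_space - closure (cf_limit_set I)"
proof -
  have Re: "1 < Re w"
    using w by (simp add: cf_gap_def)
  then have "w \<noteq> 0"
    by auto
  have "1 / w \<notin> closure (cf_limit_set I)"
  proof
    assume "1 / w \<in> closure (cf_limit_set I)"
    then obtain j k where jk: "j \<in> I" "k \<in> closure (cf_limit_set I)" "1 / (1 / w) = j + k"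
      by (rule closure_cf_limit_setE[OF I]) (use \<open>w \<noteq> 0\<close> in auto)
    then have "w - j \<in> cf_space"
      using closure_cf_limit_set_subset[OF I] by auto
    then show False
      using w jk(1) by (simp add: cf_gap_def)
  qed
  with inverse_in_interior_cf_space[OF Re] show ?thesis
    by simp
qed

text \<open>Each disc j + X lies within distance 1 of j, which costs one unit of radius; the bound
  on \<open>Re y\<close> keeps the smaller ball in the half plane.\<close>

lemma ball_subset_cf_gap:
  assumes "I \<inter> ball y \<delta> = {}" "\<delta> \<le> Re y"
  shows "ball y (\<delta> - 1) \<subseteq> cf_gap I"
proof
  fix v
  assume v: "v \<in> ball y (\<delta> - 1)"
  have "Re y - Re v \<le> dist y v"
    using complex_Re_le_cmod[of "y - v"] by (simp add: dist_norm)
  then have "1 < Re v"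
    using v assms(2) by simp
  moreover have "v - j \<notin> cf_space" if "j \<in> I" for j
  proof
    assume "v - j \<in> cf_space"
    then have "dist v j \<le> 1"
      using cf_spaceD(2) by (simp add: dist_norm)
    then have "dist y j < \<delta>"
      using v dist_triangle[of y j v] by simp
    then show False
      using assms(1) that by auto
  qed
  ultimately show "v \<in> cf_gap I"
    by (simp add: cf_gap_def)
qed

text \<open>The discs \<open>j + X\<close> have radius \<open>1/2\<close> and centres on a translate of the Gaussian integers, so
  the centre of a unit square spanned by four neighbouring centres is at distance
  \<open>1/\<surd>2 > 1/2 + 1/5\<close> from all centres.\<close>

lemma ball_interstice_subset_cf_gap:
  assumes I: "I \<subseteq> cf_alphabet" and e: "e \<in> I"
  shows "ball (e + Complex 1 (1/2)) (1/5) \<subseteq> cf_gap I"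
proof
  fix v
  let ?p = "e + Complex 1 (1/2)"
  assume v: "v \<in> ball ?p (1/5)"
  have "Re ?p - Re v \<le> dist ?p v"
    using complex_Re_le_cmod[of "?p - v"] by (simp add: dist_norm)
  moreover have "1 \<le> Re e"
    using Re_cf_alphabet I e by blast
  ultimately have "1 < Re v"
    using v by simp
  moreover have "v - j \<notin> cf_space" if j: "j \<in> I" for j
  proof
    assume "v - j \<in> cf_space"
    then have "dist (j + 1/2) v \<le> 1/2"
      by (simp add: cf_space_def dist_norm algebra_simps)
    then have d: "dist ?p (j + 1/2) < 7/10"
      using v dist_triangle[of ?p "j + 1/2" v] by (simp add: dist_commute)
    obtain m n :: int where mn: "e - j = Complex m n"
      using cf_alphabet_diff e j I by blast
    have "?p - (j + 1/2) = Complex (m + 1/2) (n + 1/2)"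
      using mn by (simp add: complex_eq_iff)
    then have "(dist ?p (j + 1/2))\<^sup>2 = (m + 1/2)\<^sup>2 + (n + 1/2)\<^sup>2"
      by (simp add: dist_norm cmod_power2)
    moreover have "1/4 \<le> (real_of_int k + 1/2)\<^sup>2" for k :: int
    proof -
      have "0 \<le> k * (k + 1)"
        by (cases "0 \<le> k") (auto simp: zero_le_mult_iff)
      then have "0 \<le> real_of_int k * (real_of_int k + 1)"
        by (metis of_int_0_le_iff of_int_1 of_int_add of_int_mult)
      then show ?thesis
        by (simp add: power2_eq_square algebra_simps)
    qed
    from this[of m] this[of n] have "1/2 \<le> (m + 1/2)\<^sup>2 + (n + 1/2 :: real)\<^sup>2"
      by linarith
    ultimately have "1/2 \<le> (dist ?p (j + 1/2))\<^sup>2"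
      by simp
    also have "\<dots> \<le> (7/10)\<^sup>2"
      using d by (intro power_mono) auto
    finally show False
      by (simp add: power2_eq_square)
  qed
  ultimately show "v \<in> cf_gap I"
    by (simp add: cf_gap_def)
qed

text \<open>The origin is not a gap point, so \<delta> \<le> |y|. Hence points v of the small ball
  satisfy |v| > 1 / (2 |y|), and inversion expands their distance to 1 / y by at most 2
  |y|^2.\<close>

lemma inverse_ball_cf_gap:
  assumes I: "I \<subseteq> cf_alphabet" and gap: "ball y \<delta> \<subseteq> cf_gap I" and "0 < \<delta>"
  shows "y \<noteq> 0" "\<delta> \<le> cmod y"
    "ball (1 / y) (\<delta> / (2 * (cmod y)\<^sup>2)) \<subseteq> interior cf_space - closure (cf_limit_set I)"
proof -
  have "0 \<notin> cf_gap I"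
    by (simp add: cf_gap_def)
  then have "0 \<notin> ball y \<delta>"
    using gap by blast
  then show \<delta>: "\<delta> \<le> cmod y"
    by simp
  with \<open>0 < \<delta>\<close> show y0: "y \<noteq> 0"
    by auto
  show "ball (1 / y) (\<delta> / (2 * (cmod y)\<^sup>2)) \<subseteq> interior cf_space - closure (cf_limit_set I)"
  proof
    fix v
    assume "v \<in> ball (1 / y) (\<delta> / (2 * (cmod y)\<^sup>2))"
    then have dv: "dist (1 / y) v < \<delta> / (2 * (cmod y)\<^sup>2)"
      by simp
    also have "\<dots> \<le> cmod y / (2 * (cmod y)\<^sup>2)"
      using \<delta> by (intro divide_right_mono) auto
    also have "\<dots> = cmod (1 / y) / 2"
      using y0 by (simp add: power2_eq_square norm_divide)
    finally have "cmod (1 / y) - cmod v < cmod (1 / y) / 2"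
      using norm_triangle_ineq2[of "1 / y" v] by (simp add: dist_norm)
    then have nv: "1 / (2 * cmod y) < cmod v"
      by (simp add: norm_divide)
    moreover have "0 < 1 / (2 * cmod y)"
      using y0 by simp
    ultimately have v0: "v \<noteq> 0"
      by auto
    have "dist y (1 / v) = dist (1 / y) v * cmod y / cmod v"
      using inverse_dist[of "1 / y" v] y0 v0 by (simp add: norm_divide)
    also have "\<dots> \<le> dist (1 / y) v * cmod y / (1 / (2 * cmod y))"
      using nv y0 v0 by (intro divide_left_mono) auto
    also have "\<dots> = dist (1 / y) v * (2 * (cmod y)\<^sup>2)"
      by (simp add: power2_eq_square)
    also have "\<dots> < \<delta>"
      using dv y0 by (simp add: pos_less_divide_eq)
    finally have "1 / v \<in> cf_gap I"
      using gap by auto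
    then show "v \<in> interior cf_space - closure (cf_limit_set I)"
      using inverse_cf_gap[OF I] v0 by fastforce
  qed
qed

text \<open>The given gap may lie outside the half plane \<open>Re w > 1\<close>, where it carries no information. It
  is therefore searched for around a letter to the right of \<open>e\<close>; if there is no such letter, the
  region to the right of \<open>e\<close> is itself a gap.\<close>

lemma gaps_near_letters:
  assumes I: "I \<subseteq> cf_alphabet"
    and params: "0 < \<theta>" "\<theta> < 1" "0 < \<kappa>" "\<kappa> < 1" "0 < \<rho>"
    and gaps: "\<And>i R. \<lbrakk>i \<in> I; \<rho> \<le> R; R \<le> \<kappa> * cmod i\<rbrakk> \<Longrightarrow> \<exists>y\<in>ball i R. I \<inter> ball y (\<theta> * R) = {}"
  obtains a d where "0 < a" "a \<le> 1/2" "0 < d" "d \<le> 1/2"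
    "\<And>e R. \<lbrakk>e \<in> I; 2 \<le> R; R \<le> max 2 (a * cmod e)\<rbrakk> \<Longrightarrow>
      \<exists>y. ball y (d * R) \<subseteq> cf_gap I \<and> dist y e \<le> R \<and> cmod e / 2 \<le> cmod y \<and> cmod y \<le> 3 * cmod e"
proof -
  \<comment> \<open>From R1 on, R / 8 is at least \<open>\<rho>\<close> and \<theta> R / 8 is at
    least 2, so a unit of radius can be given up. Below R1 the choice of d makes d R at most 1/5,
    the radius of the interstices.\<close>
  define R1 where "R1 = max (8 * \<rho>) (16 / \<theta>)"
  define d where "d = 1 / (5 * R1)"
  have "16 < 16 / \<theta>"
    using params by (simp add: field_simps)
  then have R1: "8 * \<rho> \<le> R1" "16 / \<theta> \<le> R1" "16 < R1"
    by (auto simp: R1_def)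
  have d: "0 < d" "d * R1 = 1/5"
    using R1(3) by (auto simp: d_def)
  have "d \<le> 1 / (5 * (16 / \<theta>))"
    unfolding d_def using R1(2) params by (intro frac_le) auto
  then have d\<theta>: "d \<le> \<theta> / 80"
    by simp
  show thesis
  \<comment> \<open>The letter i found near e may have modulus as small as |e| / 2; halving
    \<open>\<kappa>\<close> compensates for this.\<close>
  proof (rule that[of "\<kappa> / 2" d])
    show "0 < \<kappa> / 2" "\<kappa> / 2 \<le> 1/2" "0 < d" "d \<le> 1/2"
      using params d d\<theta> by auto
  next
    fix e R
    assume e: "e \<in> I" and R: "2 \<le> R" "R \<le> max 2 (\<kappa> / 2 * cmod e)"
    have e1: "1 \<le> cmod e" "1 \<le> Re e"
      using e I one_le_cmod_cf_alphabet Re_cf_alphabet by auto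
    show "\<exists>y. ball y (d * R) \<subseteq> cf_gap I \<and> dist y e \<le> R \<and> cmod e / 2 \<le> cmod y \<and> cmod y \<le> 3 * cmod e"
    proof (cases "R < R1")
      case True
      let ?y = "e + Complex 1 (1/2)"
      have "d * R \<le> 1/5"
        using True d mult_left_mono[of R R1 d] by linarith
      then have "ball ?y (d * R) \<subseteq> cf_gap I"
        using ball_interstice_subset_cf_gap[OF I e] subset_ball by blast
      moreover have "dist ?y e \<le> 3/2"
        using cmod_le[of "Complex 1 (1/2)"] by (simp add: dist_norm)
      moreover have "cmod e - cmod ?y \<le> dist ?y e" "cmod ?y - cmod e \<le> dist ?y e"
        by (metis dist_norm norm_minus_commute norm_triangle_ineq2) (metis dist_norm norm_triangle_ineq2)
      \<comment> \<open>Together with |y| \<ge> |e| - 3/2 this gives |y| \<ge> |e| / 2 for small |e|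
        as well.\<close>
      moreover have "2 \<le> cmod ?y"
        using e1(2) complex_Re_le_cmod[of ?y] by simp
      ultimately show ?thesis
        using R(1) e1(1) by (intro exI[of _ ?y]) auto
    next
      case False
      then have RR1: "R1 \<le> R" "16 < R"
        using R1(3) by auto
      then have Re: "R \<le> \<kappa> / 2 * cmod e"
        using R(2) by linarith
      have dR: "d * R \<le> \<theta> * R / 8 - 1" "d * R \<le> R / 8 - 1"
      proof -
        have "16 / \<theta> \<le> R"
          using R1(2) RR1(1) by simp
        then have "16 \<le> \<theta> * R"
          using params by (simp add: field_simps)
        moreover have "d * R \<le> \<theta> / 80 * R"
          using d\<theta> RR1(2) by (intro mult_right_mono) auto
        ultimately show "d * R \<le> \<theta> * R / 8 - 1"
          by simp
        also have "\<dots> \<le> R / 8 - 1"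
          using params RR1(2) by simp
        finally show "d * R \<le> R / 8 - 1" .
      qed
      have Rhalf: "R \<le> cmod e / 2"
      proof -
        have "\<kappa> / 2 * cmod e \<le> 1 / 2 * cmod e"
          using params by (intro mult_right_mono) auto
        with Re show ?thesis
          by simp
      qed
      obtain y where y: "ball y (d * R) \<subseteq> cf_gap I" "dist y e \<le> R"
      proof (cases "I \<inter> ball (e + of_real (R / 2)) (R / 8) = {}")
        case True
        have "ball (e + of_real (R / 2)) (R / 8 - 1) \<subseteq> cf_gap I"
          using e1(2) RR1(2) by (intro ball_subset_cf_gap True) simp
        moreover have "dist (e + of_real (R / 2)) e \<le> R"
          using RR1(2) by (simp add: dist_norm norm_divide)
        ultimately show thesis
          using that subset_ball[OF dR(2)] by blast
      next
        case False
        let ?p = "e + of_real (R / 2)"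
        obtain i where i: "i \<in> I" "dist ?p i < R / 8"
          using False by auto
        have pe: "dist e ?p = R / 2"
          using RR1(2) by (simp add: dist_norm norm_divide)
        then have "dist e i \<le> R"
          using i(2) dist_triangle[of e i ?p] RR1(2) by linarith
        then have "cmod e - cmod i \<le> R"
          by (metis dist_norm norm_triangle_ineq2 order_trans)
        then have "\<kappa> * (cmod e / 2) \<le> \<kappa> * cmod i"
          using Rhalf params by (intro mult_left_mono) auto
        then have "R / 8 \<le> \<kappa> * cmod i"
          using Re RR1(2) by simp
        moreover have "\<rho> \<le> R / 8"
          using R1(1) RR1(1) by simp
        ultimately have "\<exists>y\<in>ball i (R / 8). I \<inter> ball y (\<theta> * (R / 8)) = {}"
          by (intro gaps i(1))
        then obtain y where "y \<in> ball i (R / 8)" and y: "I \<inter> ball y (\<theta> * (R / 8)) = {}"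
          by (rule bexE)
        then have iy: "dist i y < R / 8"
          by simp
        have "dist ?p y < R / 4"
          using dist_triangle[of ?p y i] i(2) iy by linarith
        moreover have "Re ?p - Re y \<le> dist ?p y"
          using complex_Re_le_cmod[of "?p - y"] by (simp add: dist_norm)
        ultimately have "R / 8 \<le> Re y"
          using e1(2) RR1(2) by simp
        moreover have "\<theta> * (R / 8) \<le> R / 8"
          using params RR1(2) by simp
        ultimately have "ball y (\<theta> * (R / 8) - 1) \<subseteq> cf_gap I"
          by (intro ball_subset_cf_gap y) simp
        moreover have "d * R \<le> \<theta> * (R / 8) - 1"
          using dR(1) by simp
        moreover have "dist y e \<le> R"
          using \<open>dist ?p y < R / 4\<close> pe dist_triangle[of y e ?p] RR1(2)
          by (simp add: dist_commute)
        ultimately show thesis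
          using that subset_ball by blast
      qed
      moreover have "cmod e - cmod y \<le> dist y e" "cmod y - cmod e \<le> dist y e"
        by (metis dist_norm norm_minus_commute norm_triangle_ineq2) (metis dist_norm norm_triangle_ineq2)
      ultimately show ?thesis
        using Rhalf e1(1) by (intro exI[of _ y]) auto
    qed
  qed
qed

text \<open>Near the real point q = P M there is either no letter, and then a gap, or a letter of
  modulus comparable to M, whose neighbourhood of radius a |e| supplies a gap.\<close>

lemma gaps_far:
  assumes "0 < a" "a \<le> 1/2" "0 < d" "d \<le> 1/2"
    and gaps: "\<And>e R. \<lbrakk>e \<in> I; 2 \<le> R; R \<le> max 2 (a * cmod e)\<rbrakk> \<Longrightarrow>
      \<exists>y. ball y (d * R) \<subseteq> cf_gap I \<and> dist y e \<le> R \<and> cmod e / 2 \<le> cmod y \<and> cmod y \<le> 3 * cmod e"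
  obtains b L where "0 < b" "1 \<le> L"
    "\<And>M. 1 \<le> M \<Longrightarrow> \<exists>y. ball y (b * M) \<subseteq> cf_gap I \<and> M \<le> cmod y \<and> cmod y \<le> L * M"
proof -
  \<comment> \<open>P \<ge> 8 absorbs the lost unit of radius and keeps |y| above M; P \<ge> 4 / a
    makes the radius a |e| at least 2.\<close>
  define P where "P = max 8 (4 / a)"
  have P: "8 \<le> P" "4 / a \<le> P"
    by (auto simp: P_def)
  then have aP: "4 \<le> a * P"
    using assms(1) by (simp add: field_simps)
  show thesis
  proof (rule that[of "d * a * P / 2" "4 * P"])
    show "0 < d * a * P / 2" "1 \<le> 4 * P"
      using assms P by auto
  next
    fix M :: real
    assume M: "1 \<le> M"
    define q where "q = P * M"
    have qM: "8 * M \<le> q" "4 * M \<le> a * q"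
      using P(1) aP M unfolding q_def by (simp_all add: mult_right_mono flip: mult.assoc)
    have b: "d * a * P / 2 * M = d * (a * (q / 2))"
      by (simp add: q_def)
    show "\<exists>y. ball y (d * a * P / 2 * M) \<subseteq> cf_gap I \<and> M \<le> cmod y \<and> cmod y \<le> 4 * P * M"
    proof (cases "I \<inter> ball (of_real q) (q / 4) = {}")
      case True
      then have "ball (of_real q) (q / 4 - 1) \<subseteq> cf_gap I"
        using qM(1) M by (intro ball_subset_cf_gap) auto
      moreover have "d * (a * (q / 2)) \<le> 1/2 * (1/2 * (q / 2))"
        using assms qM(1) M by (intro mult_mono) auto
      then have "d * a * P / 2 * M \<le> q / 4 - 1"
        unfolding b using qM(1) M by linarith
      ultimately have "ball (of_real q) (d * a * P / 2 * M) \<subseteq> cf_gap I"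
        using subset_ball by blast
      moreover have "M \<le> cmod (of_real q)" "cmod (of_real q) \<le> 4 * q"
        using qM(1) M by simp_all
      ultimately show ?thesis
        unfolding q_def mult.assoc by blast
    next
      case False
      then obtain e where e: "e \<in> I" "dist (of_real q) e < q / 4"
        by auto
      have "q - cmod e \<le> dist (of_real q) e" "cmod e - q \<le> dist (of_real q) e"
        using norm_triangle_ineq2[of "of_real q" e] norm_triangle_ineq2[of e "of_real q"] qM(1) M
        by (simp_all add: dist_norm norm_minus_commute)
      then have ne: "3 / 4 * q < cmod e" "cmod e < 5 / 4 * q"
        using e(2) by linarith+
      have "a * (3 / 4 * q) \<le> a * cmod e"
        using ne(1) assms(1) by (intro mult_left_mono) auto
      then have ae: "2 \<le> a * cmod e" "a * (q / 2) \<le> a * cmod e"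
        using qM(2) M by auto
      then obtain y where y: "ball y (d * (a * cmod e)) \<subseteq> cf_gap I"
        "cmod e / 2 \<le> cmod y" "cmod y \<le> 3 * cmod e"
        using gaps[OF e(1), of "a * cmod e"] by auto
      have "d * a * P / 2 * M \<le> d * (a * cmod e)"
        unfolding b by (rule mult_left_mono[OF ae(2)]) (use assms(3) in simp)
      then have "ball y (d * a * P / 2 * M) \<subseteq> cf_gap I"
        using y(1) subset_ball by blast
      moreover have "M \<le> cmod y" "cmod y \<le> 4 * q"
        using y(2,3) ne qM(1) M by linarith+
      ultimately show ?thesis
        unfolding q_def mult.assoc by blast
    qed
  qed
qed

section \<open>Holes at all scales\<close>

lemma inverse_hole:
  assumes I: "I \<subseteq> cf_alphabet" and gap: "ball y \<delta> \<subseteq> cf_gap I" "0 < \<delta>"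
    and "s \<le> \<delta> / (2 * (cmod y)\<^sup>2)" "dist (1 / y) x + \<delta> / (2 * (cmod y)\<^sup>2) \<le> t"
  shows "ball (1 / y) s \<subseteq> ball x t \<inter> (interior cf_space - closure (cf_limit_set I))"
proof -
  have "ball (1 / y) s \<subseteq> ball (1 / y) (\<delta> / (2 * (cmod y)\<^sup>2))"
    using assms(4) by (rule subset_ball)
  moreover have "ball (1 / y) (\<delta> / (2 * (cmod y)\<^sup>2)) \<subseteq> ball x t"
    using assms(5) by (simp add: ball_subset_ball_iff)
  ultimately show ?thesis
    using inverse_ball_cf_gap(3)[OF I gap] by blast
qed

text \<open>In this range of t, inversion turns the ball into a neighbourhood of e of size about t
  |e|^2, at most a multiple of |e|, where \<open>near\<close> applies.\<close>

lemma holes_near_first_level: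
  assumes I: "I \<subseteq> cf_alphabet"
    and ad: "0 < a" "a \<le> 1/2" "0 < d" "d \<le> 1/2"
    and near: "\<And>e R. \<lbrakk>e \<in> I; 2 \<le> R; R \<le> max 2 (a * cmod e)\<rbrakk> \<Longrightarrow>
      \<exists>y. ball y (d * R) \<subseteq> cf_gap I \<and> dist y e \<le> R \<and> cmod e / 2 \<le> cmod y \<and> cmod y \<le> 3 * cmod e"
    and e: "e \<in> I" and z: "z \<in> cf_space" and t: "16 / (cmod e)\<^sup>2 \<le> t" "t \<le> 4 / cmod e"
  shows "\<exists>y. ball y (d * a / 72 * t) \<subseteq>
    ball (1 / (e + z)) t \<inter> (interior cf_space - closure (cf_limit_set I))"
proof -
  let ?N = "cmod e"
  let ?w = "e + z"
  have eE: "e \<in> cf_alphabet"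
    using e I by blast
  have N1: "1 \<le> ?N" "0 < ?N" "e \<noteq> 0"
    using one_le_cmod_cf_alphabet[OF eE] by auto
  note w = cmod_add_bounds[OF eE z]
  have w0: "?w \<noteq> 0"
    by (rule add_nonzero[OF eE z])
  have tN: "16 \<le> t * ?N\<^sup>2" "t * ?N \<le> 4"
    using t N1 by (simp_all add: pos_divide_le_eq pos_le_divide_eq)
  \<comment> \<open>The minimum with a |e| costs only a constant factor because t |e| \<le> 4; the
    maximum with 2 is harmless because t |e|^2 \<ge> 16.\<close>
  define R where "R = max 2 (min (a * ?N) (t * ?N\<^sup>2 / 8))"
  have R: "2 \<le> R" "R \<le> max 2 (a * ?N)" "R \<le> t * ?N\<^sup>2 / 8"
    using tN(1) by (auto simp: R_def)
  have "a * (t * ?N\<^sup>2 / 4) \<le> R"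
  proof -
    have "a * (t * ?N\<^sup>2 / 4) = a * ?N * (t * ?N / 4)"
      by (simp add: power2_eq_square)
    also have "\<dots> \<le> a * ?N * 1"
      using tN(2) ad N1 by (intro mult_left_mono) auto
    finally have "a * (t * ?N\<^sup>2 / 4) \<le> a * ?N"
      by simp
    moreover have "a * (t * ?N\<^sup>2 / 4) \<le> 1/2 * (t * ?N\<^sup>2 / 4)"
      using ad tN(1) by (intro mult_right_mono) auto
    ultimately show ?thesis
      by (simp add: R_def)
  qed
  then have Rlow: "a * t / 4 \<le> R / ?N\<^sup>2"
    using N1 by (simp add: pos_le_divide_eq mult_ac)
  have Rup: "R / ?N\<^sup>2 \<le> t / 8"
    using R(3) N1 by (simp add: pos_divide_le_eq)
  obtain y where y: "ball y (d * R) \<subseteq> cf_gap I" "dist y e \<le> R" "?N / 2 \<le> cmod y" "cmod y \<le> 3 * ?N"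
    using near[OF e R(1,2)] by blast
  have y0: "y \<noteq> 0"
    using y(3) N1 by auto
  define \<delta> where "\<delta> = d * R / (2 * (cmod y)\<^sup>2)"
  have "dist e ?w \<le> 1"
    using cf_spaceD(2)[OF z] by (simp add: dist_norm)
  then have "dist y ?w \<le> 3 / 2 * R"
    using y(2) R(1) dist_triangle[of y ?w e] by linarith
  then have "dist y ?w / (cmod y * cmod ?w) \<le> 3 / 2 * R / (?N / 2 * (?N / 2))"
    using y(3) w(2) N1 R(1) by (intro frac_le mult_mono mult_pos_pos) auto
  then have dist: "dist (1 / y) (1 / ?w) \<le> 6 * (R / ?N\<^sup>2)"
    using inverse_dist[OF y0 w0] by (simp add: power2_eq_square)
  have "\<delta> \<le> 1/2 * R / (2 * (?N / 2)\<^sup>2)"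
    unfolding \<delta>_def using y(3) ad R(1) N1
    by (intro frac_le mult_right_mono mult_left_mono power_mono) auto
  then have up: "\<delta> \<le> R / ?N\<^sup>2"
    by (simp add: power2_eq_square)
  have "d * R / (2 * (3 * ?N)\<^sup>2) \<le> \<delta>"
    unfolding \<delta>_def using y(4) y0 ad R(1) by (intro frac_le mult_left_mono power_mono) auto
  then have low: "d / 18 * (R / ?N\<^sup>2) \<le> \<delta>"
    by (simp add: power2_eq_square)
  \<comment> \<open>72 = 18 * 4: the 18 stems from |y| \<le> 3 |e| in the radius d R / (2 |y|^2),
    the 4 from the lower bound for R.\<close>
  have "d * a / 72 * t = d / 18 * (a * t / 4)"
    by simp
  also have "\<dots> \<le> d / 18 * (R / ?N\<^sup>2)"
    using Rlow ad by (intro mult_left_mono) auto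
  also note low
  finally have "d * a / 72 * t \<le> \<delta>" .
  moreover have "0 \<le> R / ?N\<^sup>2"
    using R(1) by simp
  then have "dist (1 / y) (1 / ?w) + \<delta> \<le> t"
    using dist up Rup by linarith
  ultimately have "ball (1 / y) (d * a / 72 * t) \<subseteq>
      ball (1 / ?w) t \<inter> (interior cf_space - closure (cf_limit_set I))"
    unfolding \<delta>_def using ad R(1) by (intro inverse_hole[OF I y(1)]) auto
  then show ?thesis
    by blast
qed

text \<open>For t beyond 4 / |e| the centre has modulus at most t / 2, so the ball surrounds 0 and
  the inverse of a distant gap fits into it.\<close>

lemma holes_first_level:
  assumes I: "I \<subseteq> cf_alphabet"
    and ad: "0 < a" "a \<le> 1/2" "0 < d" "d \<le> 1/2"
    and near: "\<And>e R. \<lbrakk>e \<in> I; 2 \<le> R; R \<le> max 2 (a * cmod e)\<rbrakk> \<Longrightarrow>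
      \<exists>y. ball y (d * R) \<subseteq> cf_gap I \<and> dist y e \<le> R \<and> cmod e / 2 \<le> cmod y \<and> cmod y \<le> 3 * cmod e"
  obtains c where "0 < c"
    "\<And>e z t. \<lbrakk>e \<in> I; z \<in> cf_space; 16 / (cmod e)\<^sup>2 \<le> t; t \<le> 64\<rbrakk> \<Longrightarrow>
      \<exists>y. ball y (c * t) \<subseteq> ball (1 / (e + z)) t \<inter> (interior cf_space - closure (cf_limit_set I))"
proof -
  obtain b L where bL: "0 < b" "1 \<le> L"
    and far: "\<And>M. 1 \<le> M \<Longrightarrow> \<exists>y. ball y (b * M) \<subseteq> cf_gap I \<and> M \<le> cmod y \<and> cmod y \<le> L * M"
    using gaps_far[OF ad near] by blast
  define c where "c = min (d * a / 72) (b / (128 * L\<^sup>2))"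
  show thesis
  proof (rule that[of c])
    show "0 < c"
      using ad bL by (simp add: c_def)
  next
    fix e z t
    assume e: "e \<in> I" and z: "z \<in> cf_space" and t: "16 / (cmod e)\<^sup>2 \<le> t" "t \<le> 64"
    let ?w = "e + z"
    have eE: "e \<in> cf_alphabet"
      using e I by blast
    have N1: "1 \<le> cmod e" "e \<noteq> 0"
      using one_le_cmod_cf_alphabet[OF eE] by auto
    have "0 < 16 / (cmod e)\<^sup>2"
      using N1 by simp
    then have t0: "0 < t"
      using t(1) by linarith
    have c: "c * t \<le> d * a / 72 * t" "c * t \<le> b / (128 * L\<^sup>2) * t"
      unfolding c_def using t0 by (intro mult_right_mono; simp)+
    show "\<exists>y. ball y (c * t) \<subseteq> ball (1 / ?w) t \<inter> (interior cf_space - closure (cf_limit_set I))"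
    proof (cases "t \<le> 4 / cmod e")
      case True
      then show ?thesis
        using holes_near_first_level[OF I ad near e z t(1)] subset_ball[OF c(1)] by (meson order_trans)
    next
      case False
      \<comment> \<open>Then |1 / y| \<le> t / 4, so the hole stays in the ball since t/4 + t/2 +
        t/8 \<le> t. The maximum with 1 is what \<open>far\<close> requires, and t \<le> 64 still
        gives M \<le> 64 / t.\<close>
      define M where "M = max 1 (4 / t)"
      have M: "1 \<le> M" "4 / t \<le> M" "M \<le> 64 / t"
        using t(2) t0 by (auto simp: M_def pos_le_divide_eq divide_right_mono)
      have "1 / M \<le> 1 / (4 / t)"
        using M t0 by (intro divide_left_mono) auto
      then have Mt: "1 / M \<le> t / 4"
        by simp
      obtain y where y: "ball y (b * M) \<subseteq> cf_gap I" "M \<le> cmod y" "cmod y \<le> L * M"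
        using far[OF M(1)] by blast
      have bM: "0 < b * M"
        using bL M(1) by simp
      note gap = inverse_ball_cf_gap[OF I y(1) bM]
      define \<delta> where "\<delta> = b * M / (2 * (cmod y)\<^sup>2)"
      have y1: "cmod (1 / y) \<le> 1 / M"
        using y(2) M(1) gap(1) by (simp add: norm_divide frac_le)
      have "\<delta> \<le> cmod y / (2 * (cmod y)\<^sup>2)"
        unfolding \<delta>_def using gap(2) by (intro divide_right_mono) auto
      also have "\<dots> = cmod (1 / y) / 2"
        using gap(1) by (simp add: power2_eq_square norm_divide)
      finally have up: "\<delta> \<le> cmod (1 / y) / 2" .
      have "1 / cmod ?w \<le> 1 / (cmod e / 2)"
        using cmod_add_bounds[OF eE z] N1 by (intro frac_le) auto
      then have w: "cmod (1 / ?w) \<le> t / 2"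
        using False by (simp add: norm_divide)
      have "dist (1 / y) (1 / ?w) \<le> cmod (1 / y) + cmod (1 / ?w)"
        unfolding dist_norm by (rule norm_triangle_ineq4)
      then have "dist (1 / y) (1 / ?w) + \<delta> \<le> t"
        using up y1 Mt w t0 by linarith
      moreover have "b / (128 * L\<^sup>2) * t \<le> \<delta>"
      proof -
        have "b / (128 * L\<^sup>2) * t = b / (2 * L\<^sup>2) / (64 / t)"
          by simp
        also have "\<dots> \<le> b / (2 * L\<^sup>2) / M"
          using M bL t0 by (intro divide_left_mono) auto
        also have "\<dots> = b * M / (2 * (L * M)\<^sup>2)"
          using M(1) by (simp add: power2_eq_square)
        also have "\<dots> \<le> \<delta>"
          unfolding \<delta>_def using y(3) gap(1) bL M(1) by (intro frac_le mult_left_mono power_mono) auto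
        finally show ?thesis .
      qed
      ultimately have "ball (1 / y) (c * t) \<subseteq>
          ball (1 / ?w) t \<inter> (interior cf_space - closure (cf_limit_set I))"
        unfolding \<delta>_def using c(2) by (intro inverse_hole[OF I y(1) bM]) auto
      then show ?thesis
        by blast
    qed
  qed
qed

section \<open>Transport of holes to all scales\<close>

text \<open>Expansion makes f injective, so invariance of domain gives an open image; the bounding
  sphere is sent to distance at least m \<rho> from f y.\<close>

lemma ball_subset_image:
  fixes f :: "'a::euclidean_space \<Rightarrow> 'a"
  assumes cont: "continuous_on S f" and S: "cball y \<rho> \<subseteq> S" and "0 < \<rho>" "0 < m"
    and expand: "\<And>z w. \<lbrakk>z \<in> S; w \<in> S\<rbrakk> \<Longrightarrow> m * dist z w \<le> dist (f z) (f w)"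
  shows "ball (f y) (m * \<rho>) \<subseteq> f ` ball y \<rho>"
proof -
  have S': "ball y \<rho> \<subseteq> S" "y \<in> S"
    using S ball_subset_cball \<open>0 < \<rho>\<close> by (auto simp: subset_iff)
  have "inj_on f S"
  proof (rule inj_onI)
    fix z w
    assume zw: "z \<in> S" "w \<in> S" "f z = f w"
    then have "m * dist z w \<le> 0"
      using expand[of z w] by simp
    then show "z = w"
      using \<open>0 < m\<close> by (simp add: mult_le_0_iff)
  qed
  then have op: "open (f ` ball y \<rho>)"
    using S'(1) cont by (intro invariance_of_domain) (auto intro: continuous_on_subset inj_on_subset)
  have cl: "closed (f ` cball y \<rho>)"
    using S cont by (intro compact_imp_closed compact_continuous_image) (auto intro: continuous_on_subset)
  have sub: "v \<in> f ` ball y \<rho>" if v: "v \<in> ball (f y) (m * \<rho>)" "v \<in> f ` cball y \<rho>" for v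
  proof -
    obtain u where u: "u \<in> cball y \<rho>" "v = f u"
      using v(2) by blast
    have "m * dist y u \<le> dist (f y) (f u)"
      using u(1) S S'(2) by (intro expand) auto
    also have "\<dots> < m * \<rho>"
      using v(1) u(2) by simp
    finally have "u \<in> ball y \<rho>"
      using \<open>0 < m\<close> by simp
    with u(2) show ?thesis
      by blast
  qed
  \<comment> \<open>Inside the connected target ball the images of the open and the closed ball
    agree, so this image is relatively open and closed, and it contains f y.\<close>
  have "- (f ` cball y \<rho>) \<inter> ball (f y) (m * \<rho>) = {}"
  proof (rule ccontr)
    assume ne: "- (f ` cball y \<rho>) \<inter> ball (f y) (m * \<rho>) \<noteq> {}"
    have "f y \<in> f ` ball y \<rho> \<inter> ball (f y) (m * \<rho>)"
      using \<open>0 < \<rho>\<close> \<open>0 < m\<close> by simp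
    moreover have "f ` ball y \<rho> \<inter> - (f ` cball y \<rho>) \<inter> ball (f y) (m * \<rho>) = {}"
      using ball_subset_cball by blast
    moreover have "ball (f y) (m * \<rho>) \<subseteq> f ` ball y \<rho> \<union> - (f ` cball y \<rho>)"
      using sub by blast
    ultimately show False
      using connectedD[OF connected_ball op, of "- (f ` cball y \<rho>)" "f y" "m * \<rho>"] cl ne
      by (auto simp: open_Compl)
  qed
  with sub show ?thesis
    by blast
qed

text \<open>A composition is chosen whose scale brings r into the range of \<open>holes\<close>. The
  first level hole is pushed forward by it: the bilipschitz bounds control its size,
  \<open>cf_comp_in_closureD\<close> keeps it outside K.\<close>

lemma holes_in_limit_set:
  assumes I: "I \<subseteq> cf_alphabet" and "0 < c"
    and holes: "\<And>e z t. \<lbrakk>e \<in> I; z \<in> cf_space; 16 / (cmod e)\<^sup>2 \<le> t; t \<le> 64\<rbrakk> \<Longrightarrow>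
      \<exists>y. ball y (c * t) \<subseteq> ball (1 / (e + z)) t \<inter> (interior cf_space - closure (cf_limit_set I))"
    and x: "x \<in> cf_limit_set I" and r: "0 < r" "r < 1"
  shows "\<exists>y. ball y (c / 16 * r) \<subseteq> ball x r - closure (cf_limit_set I)"
proof -
  obtain \<omega> where \<omega>: "\<And>n. \<omega> n \<in> I" "x = cf_proj \<omega>"
    using x by (auto simp: cf_limit_set_def)
  then have letters: "\<And>n. \<omega> n \<in> cf_alphabet"
    using I by blast
  \<comment> \<open>256 = 4 * 64: failure at the previous index gives t \<le> 64, and success at n
    gives t |e|^2 \<ge> 16 by \<open>cf_scale_Suc_ge\<close>.\<close>
  let ?P = "\<lambda>n. 256 * cf_scale \<omega> (Suc n) \<le> r"
  define n where "n = (LEAST n. ?P n)"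
  obtain n0 where "cf_scale \<omega> (Suc n0) < r / 256"
    using cf_scale_small[of \<omega> "r / 256"] letters r(1) by auto
  then have "?P n0"
    by (simp del: cf_scale.simps)
  then have small: "?P n"
    unfolding n_def by (rule LeastI)
  have large: "r \<le> 256 * cf_scale \<omega> n"
  \<comment> \<open>For n = 0 there is no previous index; there the scale is 1 and r < 1
    suffices.\<close>
  proof (cases n)
    case 0
    then show ?thesis
      using r by simp
  next
    case (Suc m)
    then have "\<not> ?P m"
      using not_less_Least[of m ?P] by (simp add: n_def)
    then show ?thesis
      using Suc by simp
  qed
  define B where "B = cf_scale \<omega> n"
  have B: "0 < B"
    unfolding B_def by (rule cf_scale_pos[of \<omega>, OF letters])
  \<comment> \<open>4 B is the upper Lipschitz constant, so the ball of radius t is mapped into one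
    of radius r.\<close>
  define t where "t = r / (4 * B)"
  have t: "0 < t" "t \<le> 64" "4 * B * t = r"
    using r B large by (auto simp: t_def B_def field_simps)
  let ?e = "\<omega> n" and ?z = "cf_proj (\<lambda>k. \<omega> (Suc n + k))"
  let ?f = "cf_comp \<omega> n"
  have z: "?z \<in> cf_space"
    using letters by (intro cf_proj_in_cf_space)
  have fx: "x = ?f (1 / (?e + ?z))" 
    using cf_proj_eq_cf_comp[of \<omega> "Suc n"] letters \<omega>(2) by (simp add: cf_map_def)
  have fz: "1 / (?e + ?z) \<in> cf_space"
    using cf_map_in_cf_space[OF letters z] by (simp add: cf_map_def)
  have "B \<le> 4 * (cmod ?e)\<^sup>2 * cf_scale \<omega> (Suc n)"
    unfolding B_def by (rule cf_scale_Suc_ge[of \<omega>, OF letters])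
  also have "\<dots> \<le> 4 * (cmod ?e)\<^sup>2 * (r / 256)"
    using small by (intro mult_left_mono) (auto simp del: cf_scale.simps)
  finally have "64 * B \<le> r * (cmod ?e)\<^sup>2"
    by (simp add: mult_ac)
  then have "16 \<le> t * (cmod ?e)\<^sup>2"
    using B by (simp add: t_def field_simps)
  moreover have "0 < (cmod ?e)\<^sup>2"
    using one_le_cmod_cf_alphabet[OF letters[of n]] by auto
  ultimately have "16 / (cmod ?e)\<^sup>2 \<le> t"
    by (simp add: pos_divide_le_eq)
  then obtain y where y: "ball y (c * t) \<subseteq>
      ball (1 / (?e + ?z)) t \<inter> (interior cf_space - closure (cf_limit_set I))"
    using holes[OF \<omega>(1) z] t(2) by blast
  have ct: "0 < c * t"
    using t \<open>0 < c\<close> by simp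
  have "closure (ball y (c * t)) \<subseteq> cf_space"
    using y interior_subset by (intro closure_minimal) (auto simp: cf_space_def)
  then have sub: "cball y (c * t) \<subseteq> cf_space"
    using ct by simp
  have "ball (?f y) (B / 4 * (c * t)) \<subseteq> ?f ` ball y (c * t)"
  proof (rule ball_subset_image[OF continuous_on_cf_comp[OF letters] sub ct])
    show "0 < B / 4"
      using B by simp
    show "B / 4 * dist u v \<le> dist (?f u) (?f v)" if "u \<in> cf_space" "v \<in> cf_space" for u v
      unfolding B_def by (rule cf_comp_bilipschitz(1)[OF letters that])
  qed
  moreover have "B / 4 * (c * t) = c / 16 * r"
    using t(3) by simp
  moreover have "?f ` ball y (c * t) \<subseteq> ball x r - closure (cf_limit_set I)"
  proof
    fix v
    assume "v \<in> ?f ` ball y (c * t)"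
    then obtain k where "k \<in> ball y (c * t)" and v: "v = ?f k"
      by blast
    then have k: "k \<in> ball (1 / (?e + ?z)) t" "k \<in> interior cf_space" "k \<notin> closure (cf_limit_set I)"
      using y by blast+
    then have kX: "k \<in> cf_space"
      using interior_subset by blast
    have "dist x v \<le> 4 * B * dist (1 / (?e + ?z)) k"
      unfolding fx v B_def by (rule cf_comp_bilipschitz(2)[OF letters fz kX])
    also have "\<dots> < 4 * B * t"
      using k(1) B by simp
    finally have "v \<in> ball x r"
      using t(3) by simp
    moreover have "v \<notin> closure (cf_limit_set I)"
      using cf_comp_in_closureD[where \<omega> = \<omega> and n = n, OF I \<omega>(1) k(2)] k(3) v by blast
    ultimately show "v \<in> ball x r - closure (cf_limit_set I)"
      by blast
  qed
  ultimately show ?thesis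
    by (metis order_trans)
qed

text \<open>A point of the closure is replaced by a point of G within r / 2, at the cost of half the
  radius. The minimum with 1/2 meets the requirement that a porosity constant be less than
  1.\<close>

lemma porous_closureI:
  assumes "0 < c"
    and holes: "\<And>x r. \<lbrakk>x \<in> G; 0 < r; r < 1\<rbrakk> \<Longrightarrow> \<exists>y. ball y (c * r) \<subseteq> ball x r - closure G"
  shows "porous (closure G)"
proof -
  let ?c = "min (c / 2) (1/2)"
  have "?c \<le> por (closure G) x r" if x: "x \<in> closure G" and r: "0 < r" "r < 1" for x r
  proof -
    obtain x' where x': "x' \<in> G" "dist x' x < r / 2"
      using x r by (meson closure_approachable half_gt_zero)
    obtain y where y: "ball y (c * (r / 2)) \<subseteq> ball x' (r / 2) - closure G"
      using holes[OF x'(1), of "r / 2"] r by auto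
    have "?c * r \<le> c / 2 * r"
      using r by (intro mult_right_mono) auto
    then have "ball y (?c * r) \<subseteq> ball y (c * (r / 2))"
      by (intro subset_ball) simp
    moreover have "ball x' (r / 2) \<subseteq> ball x r"
      using x'(2) by (simp add: ball_subset_ball_iff)
    ultimately show ?thesis
      using y r assms(1) by (intro por_ge[of _ _ y]) auto
  qed
  then show ?thesis
    unfolding porous_def using assms(1) by (intro exI[of _ ?c] exI[of _ 1]) auto
qed

theorem theorem4p4:
  fixes I :: "complex set"
  assumes "I \<subseteq> cf_alphabet" and "infinite I"
  shows "porous (closure (cf_limit_set I)) \<longleftrightarrow>
    (\<exists>\<theta> \<kappa> \<rho>. 0 < \<theta> \<and> \<theta> < 1 \<and> 0 < \<kappa> \<and> \<kappa> < 1 \<and> 0 < \<rho> \<and>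
      (\<forall>i\<in>I. \<forall>R\<in>{\<rho>..\<kappa> * cmod i}. \<exists>y\<in>ball i R.
        cf_alphabet \<inter> ball y (\<theta> * R) \<subseteq> cf_alphabet - I))"
proof -
  have gap_iff: "cf_alphabet \<inter> ball y s \<subseteq> cf_alphabet - I \<longleftrightarrow> I \<inter> ball y s = {}" for y s
    using assms(1) by blast
  show ?thesis
    unfolding gap_iff
  proof
    assume por: "porous (closure (cf_limit_set I))"
    have "I \<noteq> {}"
      using assms(2) by auto
    from gaps_of_porous[OF assms(1) this por] obtain \<theta> \<kappa> \<rho>
      where "0 < \<theta>" "\<theta> < 1" "0 < \<kappa>" "\<kappa> < 1" "0 < \<rho>"
        "\<And>i R. \<lbrakk>i \<in> I; \<rho> \<le> R; R \<le> \<kappa> * cmod i\<rbrakk> \<Longrightarrow> \<exists>y\<in>ball i R. I \<inter> ball y (\<theta> * R) = {}"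
      by metis
    then show "\<exists>\<theta> \<kappa> \<rho>. 0 < \<theta> \<and> \<theta> < 1 \<and> 0 < \<kappa> \<and> \<kappa> < 1 \<and> 0 < \<rho> \<and>
        (\<forall>i\<in>I. \<forall>R\<in>{\<rho>..\<kappa> * cmod i}. \<exists>y\<in>ball i R. I \<inter> ball y (\<theta> * R) = {})"
      by (intro exI[of _ \<theta>] exI[of _ \<kappa>] exI[of _ \<rho>]) simp
  next
    assume "\<exists>\<theta> \<kappa> \<rho>. 0 < \<theta> \<and> \<theta> < 1 \<and> 0 < \<kappa> \<and> \<kappa> < 1 \<and> 0 < \<rho> \<and>
        (\<forall>i\<in>I. \<forall>R\<in>{\<rho>..\<kappa> * cmod i}. \<exists>y\<in>ball i R. I \<inter> ball y (\<theta> * R) = {})"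
    then obtain \<theta> \<kappa> \<rho> where params: "0 < \<theta>" "\<theta> < 1" "0 < \<kappa>" "\<kappa> < 1" "0 < \<rho>"
      and gaps: "\<And>i R. \<lbrakk>i \<in> I; \<rho> \<le> R; R \<le> \<kappa> * cmod i\<rbrakk> \<Longrightarrow> \<exists>y\<in>ball i R. I \<inter> ball y (\<theta> * R) = {}"
      by (metis atLeastAtMost_iff)
    show "porous (closure (cf_limit_set I))"
    proof (rule gaps_near_letters[OF assms(1) params])
      show "\<exists>y\<in>ball i R. I \<inter> ball y (\<theta> * R) = {}"
        if "i \<in> I" "\<rho> \<le> R" "R \<le> \<kappa> * cmod i" for i R
        using that by (rule gaps)
    next
      fix a d :: real
      assume ad: "0 < a" "a \<le> 1/2" "0 < d" "d \<le> 1/2"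
        and near: "\<And>e R. \<lbrakk>e \<in> I; 2 \<le> R; R \<le> max 2 (a * cmod e)\<rbrakk> \<Longrightarrow> \<exists>y. ball y (d * R) \<subseteq> cf_gap I \<and>
          dist y e \<le> R \<and> cmod e / 2 \<le> cmod y \<and> cmod y \<le> 3 * cmod e"
      obtain c where c: "0 < c" "\<And>e z t. \<lbrakk>e \<in> I; z \<in> cf_space; 16 / (cmod e)\<^sup>2 \<le> t; t \<le> 64\<rbrakk> \<Longrightarrow>
          \<exists>y. ball y (c * t) \<subseteq> ball (1 / (e + z)) t \<inter> (interior cf_space - closure (cf_limit_set I))"
        using holes_first_level[OF assms(1) ad near] by blast
      show ?thesis
        by (rule porous_closureI[of "c / 16"])
          (use holes_in_limit_set[OF assms(1) c] c(1) in auto)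
    qed
  qed
qed

end
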